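(* Let $G$ be a finite graph (loops and multiple edges allowed) that contains the complete graph $K_4$ as a minor. Then there does not exist a Legendrian realization of $G$ in $(\mathbb{R}^3,\xi_{std})$ such that every cycle of $G$ is realized as a knot whose topological knot class lies in $L_{odd}$ and whose Thurston-Bennequin number equals the maximal Thurston-Bennequin number of that topological class.
   Context: The standard contact structure on $\mathbb{R}^3$ is $\xi_{std}=\ker(dz-y\,dx)$. A curve is Legendrian if it is everywhere tangent to the contact planes. A Legendrian realization (Legendrian embedding) of a graph $G$ is an embedding of $G$ in $\mathbb{R}^3$ such that every edge is a smooth Legendrian curve and the edges are non-tangent to each other at the vertices, meaning: when all edge-ends at a vertex are oriented outward, no two of their tangent directions coincide in the contact plane (opposite directions are allowed). A graph $H$ is a minor of $G$ if $H$ can be obtained from a subgraph of $G$ by a finite number of edge contractions. A cycle of $G$ is a subgraph homeomorphic to a circle. The image of a cycle is a piecewise smooth Legendrian knot $K$ (a simple closed curve, smooth and Legendrian except possibly for corners at the vertices). Its Thurston-Bennequin number is $tb(K)=lk(K,K')$, where $K'$ is a small push-off of $K$ in the direction of a vector field transverse to $\xi_{std}$. The maximal Thurston-Bennequin number of a topological knot class is the maximum of $tb$ over all Legendrian knots in $(\mathbb{R}^3,\xi_{std})$ in that class. $L_{odd}$ denotes the set of topological knot classes whose maximal Thurston-Bennequin number is odd. *)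

theory Defs
  imports "HOL-Analysis.Analysis" "Graph_Theory.Digraph_Component"
begin

section \<open>Multigraphs, minors and cycles\<close>

text \<open>
  A finite undirected multigraph (loops and parallel edges allowed) is a \<^const>\<open>fin_digraph\<close>
  in which each arc is one undirected edge. The choice of tail and head is an arbitrary reference
  orientation, needed only to parametrize the edge; none of the notions below depends on it.
\<close>

definition ends :: "('v, 'e) pre_digraph \<Rightarrow> 'e \<Rightarrow> 'v set" where
  "ends G e = {tail G e, head G e}"

definition ugraph_isomorphic :: "('v, 'e) pre_digraph \<Rightarrow> ('w, 'f) pre_digraph \<Rightarrow> bool" where
  "ugraph_isomorphic G H \<longleftrightarrow>
     (\<exists>\<phi> \<psi>. bij_betw \<phi> (verts G) (verts H) \<and> bij_betw \<psi> (arcs G) (arcs H) \<and>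
        (\<forall>e\<in>arcs G. ends H (\<psi> e) = \<phi> ` ends G e))"

definition complete_graph :: "nat \<Rightarrow> (nat, nat \<times> nat) pre_digraph" where
  "complete_graph n = \<lparr>verts = {..<n}, arcs = {(i, j). i < j \<and> j < n}, tail = fst, head = snd\<rparr>"

text \<open>
  The head of \<open>e\<close> is merged into its tail. Edges parallel to \<open>e\<close> become loops;
  contracting a loop just deletes it.
\<close>

definition contract_edge :: "('v, 'e) pre_digraph \<Rightarrow> 'e \<Rightarrow> ('v, 'e) pre_digraph" where
  "contract_edge G e =
     (let q = (\<lambda>x. if x = head G e then tail G e else x)
      in \<lparr>verts = q ` verts G, arcs = arcs G - {e}, tail = q \<circ> tail G, head = q \<circ> head G\<rparr>)"

definition contracts_to :: "('v, 'e) pre_digraph \<Rightarrow> ('v, 'e) pre_digraph \<Rightarrow> bool" where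
  "contracts_to G H \<longleftrightarrow> (\<exists>e\<in>arcs G. H = contract_edge G e)"

definition minor :: "('w, 'f) pre_digraph \<Rightarrow> ('v, 'e) pre_digraph \<Rightarrow> bool" where
  "minor H G \<longleftrightarrow>
     (\<exists>S T. subgraph S G \<and> contracts_to\<^sup>*\<^sup>* S T \<and> ugraph_isomorphic T H)"

text \<open>
  A step \<open>(e, True)\<close> traverses \<open>e\<close> from tail to head, \<open>(e, False)\<close> from head to tail. The steps
  starting at a vertex are exactly the edge-ends there; a loop contributes two of them.
\<close>

definition step_start :: "('v, 'e) pre_digraph \<Rightarrow> 'e \<times> bool \<Rightarrow> 'v" where
  "step_start G s = (if snd s then tail G (fst s) else head G (fst s))"

definition step_end :: "('v, 'e) pre_digraph \<Rightarrow> 'e \<times> bool \<Rightarrow> 'v" where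
  "step_end G s = (if snd s then head G (fst s) else tail G (fst s))"

text \<open>
  A subgraph homeomorphic to a circle is given by a closed traversal that repeats neither a vertex
  nor an edge; the traversal is unique up to its starting vertex and direction. A loop is a cycle
  of length 1, and two parallel edges form a cycle of length 2.
\<close>

definition cycle :: "('v, 'e) pre_digraph \<Rightarrow> ('e \<times> bool) list \<Rightarrow> bool" where
  "cycle G w \<longleftrightarrow>
     w \<noteq> [] \<and> fst ` set w \<subseteq> arcs G \<and>
     distinct (map fst w) \<and> distinct (map (step_start G) w) \<and>
     (\<forall>i<length w. step_end G (w ! i) = step_start G (w ! (Suc i mod length w)))"


section \<open>Legendrian curves\<close>

text \<open>Coordinates are \<open>x = p $ 1\<close>, \<open>y = p $ 2\<close>, \<open>z = p $ 3\<close>; the plane is the kernel of \<open>dz - y dx\<close>.\<close>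

definition contact_plane :: "real^3 \<Rightarrow> (real^3) set" where
  "contact_plane p = {u. u $ 3 - p $ 2 * u $ 1 = 0}"

text \<open>Derivatives of all orders, one-sided at the end points of a closed interval.\<close>

definition smooth_on :: "real set \<Rightarrow> (real \<Rightarrow> 'a::real_normed_vector) \<Rightarrow> bool" where
  "smooth_on S c \<longleftrightarrow>
     (\<exists>D :: nat \<Rightarrow> real \<Rightarrow> 'a. D 0 = c \<and>
        (\<forall>n. \<forall>t\<in>S. (D n has_vector_derivative D (Suc n) t) (at t within S)))"

definition legendrian_on :: "real set \<Rightarrow> (real \<Rightarrow> real^3) \<Rightarrow> bool" where
  "legendrian_on S c \<longleftrightarrow>
     smooth_on S c \<and>
     (\<forall>t\<in>S. vector_derivative c (at t within S) \<noteq> 0 \<and>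
             vector_derivative c (at t within S) \<in> contact_plane (c t))"

text \<open>Smooth Legendrian knots, as embedded closed curves of period 1.\<close>

definition legendrian_knot :: "(real \<Rightarrow> real^3) \<Rightarrow> bool" where
  "legendrian_knot c \<longleftrightarrow>
     legendrian_on UNIV c \<and> (\<forall>t. c (t + 1) = c t) \<and> inj_on c {0..<1}"

definition step_path :: "('e \<Rightarrow> real \<Rightarrow> real^3) \<Rightarrow> 'e \<times> bool \<Rightarrow> real \<Rightarrow> real^3" where
  "step_path \<gamma> s = (if snd s then \<gamma> (fst s) else reversepath (\<gamma> (fst s)))"

definition outward_tangent :: "('e \<Rightarrow> real \<Rightarrow> real^3) \<Rightarrow> 'e \<times> bool \<Rightarrow> real^3" where
  "outward_tangent \<gamma> s = vector_derivative (step_path \<gamma> s) (at 0 within {0..1})"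

text \<open>Only the values of \<open>\<gamma> e\<close> on \<open>{0..1}\<close> matter.\<close>

definition legendrian_realization ::
  "('v, 'e) pre_digraph \<Rightarrow> ('v \<Rightarrow> real^3) \<Rightarrow> ('e \<Rightarrow> real \<Rightarrow> real^3) \<Rightarrow> bool" where
  "legendrian_realization G p \<gamma> \<longleftrightarrow>
     inj_on p (verts G) \<and>
     (\<forall>e\<in>arcs G. legendrian_on {0..1} (\<gamma> e) \<and>
        pathstart (\<gamma> e) = p (tail G e) \<and> pathfinish (\<gamma> e) = p (head G e) \<and>
        inj_on (\<gamma> e) {0<..<1} \<and> \<gamma> e ` {0<..<1} \<inter> p ` verts G = {}) \<and>
     (\<forall>e\<in>arcs G. \<forall>f\<in>arcs G. e \<noteq> f \<longrightarrow> \<gamma> e ` {0<..<1} \<inter> \<gamma> f ` {0<..<1} = {}) \<and>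
     (\<forall>s\<in>arcs G \<times> UNIV. \<forall>s'\<in>arcs G \<times> UNIV. s \<noteq> s' \<and> step_start G s = step_start G s' \<longrightarrow>
        \<not> (\<exists>r>0. outward_tangent \<gamma> s' = r *\<^sub>R outward_tangent \<gamma> s))"

fun walk_path :: "('e \<Rightarrow> real \<Rightarrow> real^3) \<Rightarrow> ('e \<times> bool) list \<Rightarrow> real \<Rightarrow> real^3" where
  "walk_path \<gamma> [] = (\<lambda>_. 0)"
| "walk_path \<gamma> [s] = step_path \<gamma> s"
| "walk_path \<gamma> (s # s' # w) = step_path \<gamma> s +++ walk_path \<gamma> (s' # w)"


section \<open>Linking and Thurston--Bennequin numbers\<close>

text \<open>
  The Gauss linking integral of piecewise smooth loops on \<open>{0..1}\<close>. With the standard orientation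
  of \<open>\<real>\<^sup>3\<close> a positive crossing contributes positively, and \<open>dz - y dx\<close> is a positive contact form,
  so that the Legendrian unknot with two cusps has Thurston--Bennequin number \<open>-1\<close>.
  The derivative is undefined at finitely many corners, which do not affect the integral.
\<close>

definition gauss_integral :: "(real \<Rightarrow> real^3) \<Rightarrow> (real \<Rightarrow> real^3) \<Rightarrow> real" where
  "gauss_integral c d =
     1 / (4 * pi) *
     integral {0..1} (\<lambda>s. integral {0..1} (\<lambda>t.
       (c s - d t) \<bullet> cross3 (vector_derivative c (at s)) (vector_derivative d (at t))
         / norm (c s - d t) ^ 3))"

definition has_linking_number :: "(real \<Rightarrow> real^3) \<Rightarrow> (real \<Rightarrow> real^3) \<Rightarrow> int \<Rightarrow> bool" where
  "has_linking_number c d n \<longleftrightarrow>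
     path_image c \<inter> path_image d = {} \<and> gauss_integral c d = of_int n"

definition transverse_field :: "(real^3 \<Rightarrow> real^3) \<Rightarrow> bool" where
  "transverse_field v \<longleftrightarrow>
     (\<exists>v' :: real^3 \<Rightarrow> ((real^3) \<Rightarrow>\<^sub>L (real^3)). continuous_on UNIV v' \<and>
        (\<forall>p. (v has_derivative blinfun_apply (v' p)) (at p))) \<and>
     (\<forall>p. v p \<notin> contact_plane p)"

lemma transverse_field_dz: "transverse_field (\<lambda>p. axis 3 1)"
  unfolding transverse_field_def
proof
  show "\<exists>v' :: real^3 \<Rightarrow> ((real^3) \<Rightarrow>\<^sub>L (real^3)). continuous_on UNIV v' \<and>
      (\<forall>p. ((\<lambda>p. axis 3 1) has_derivative blinfun_apply (v' p)) (at p))"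
    by (rule exI[of _ "\<lambda>_. 0"]) (simp add: zero_blinfun.rep_eq)
qed (simp add: contact_plane_def axis_def)

text \<open>
  \<open>has_tb v c n\<close>: for all sufficiently small \<open>\<epsilon> > 0\<close> the push-off of \<open>c\<close> by \<open>\<epsilon> v\<close> is disjoint
  from \<open>c\<close> and has linking number \<open>n\<close> with it. For piecewise Legendrian knots this determines
  \<open>n\<close>, independently of the transverse field \<open>v\<close> and of the parametrization.
\<close>

definition has_tb :: "(real^3 \<Rightarrow> real^3) \<Rightarrow> (real \<Rightarrow> real^3) \<Rightarrow> int \<Rightarrow> bool" where
  "has_tb v c n \<longleftrightarrow>
     (\<forall>\<^sub>F \<epsilon> in at_right 0. has_linking_number c (\<lambda>t. c t + \<epsilon> *\<^sub>R v (c t)) n)"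


section \<open>Knot classes\<close>

definition knot :: "(real^3) set \<Rightarrow> bool" where
  "knot K \<longleftrightarrow> K homeomorphic sphere (0::complex) 1"

definition ambient_isotopic :: "(real^3) set \<Rightarrow> (real^3) set \<Rightarrow> bool" where
  "ambient_isotopic K L \<longleftrightarrow>
     (\<exists>h :: real \<Rightarrow> real^3 \<Rightarrow> real^3.
        continuous_on ({0..1} \<times> UNIV) (\<lambda>(t, x). h t x) \<and>
        (\<forall>t\<in>{0..1}. \<exists>g. homeomorphism UNIV UNIV (h t) g) \<and>
        (\<forall>x. h 0 x = x) \<and> h 1 ` K = L)"

definition knot_class :: "(real^3) set \<Rightarrow> (real^3) set set" where
  "knot_class K = {L. ambient_isotopic K L}"

text \<open>\<open>m\<close> is the maximum of the Thurston--Bennequin numbers of the Legendrian knots in \<open>\<kappa>\<close>.\<close>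

definition has_max_tb :: "(real^3 \<Rightarrow> real^3) \<Rightarrow> (real^3) set set \<Rightarrow> int \<Rightarrow> bool" where
  "has_max_tb v \<kappa> m \<longleftrightarrow>
     (\<exists>c. legendrian_knot c \<and> path_image c \<in> \<kappa> \<and> has_tb v c m) \<and>
     (\<forall>c n. legendrian_knot c \<and> path_image c \<in> \<kappa> \<and> has_tb v c n \<longrightarrow> n \<le> m)"

definition L_odd :: "(real^3 \<Rightarrow> real^3) \<Rightarrow> (real^3) set set set" where
  "L_odd v = {\<kappa>. (\<exists>K. knot K \<and> \<kappa> = knot_class K) \<and> (\<exists>m. has_max_tb v \<kappa> m \<and> odd m)}"

end

theory Submission
  imports Defs "HOL-Library.Function_Algebras"
begin

text \<open>
  The Thurston--Bennequin number of a cycle is a quadratic function of the cycle, and a quadratic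
  function cannot be odd on all cycles of a graph with a \<open>K\<^sub>4\<close> minor.

  For a small \<open>\<epsilon> > 0\<close>, the number \<open>tb\<close> of a cycle is the Gauss integral of the cycle and its push-off
  by \<open>\<epsilon> v\<close>. This double integral is additive under concatenation of paths in both arguments and
  changes sign when a path is reversed. Hence \<open>tb\<close> of a cycle is the sum of \<open>\<plusminus>j e f\<close> over the pairs
  \<open>(e, f)\<close> of its edges, where \<open>j e f\<close> is the Gauss integral of the arc \<open>e\<close> and the push-off of the
  arc \<open>f\<close>. The real numbers \<open>j e f\<close> have no topological meaning, but they do not depend on the
  cycle: with the chain of a cycle defined as its signed edge vector, \<open>tb\<close> is \<open>Q (chain w)\<close> for one
  quadratic form \<open>Q\<close> on the space of chains (\<open>eventually_tb_eq_quadratic_form\<close>).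

  Every quadratic form satisfies
  \<open>Q a + Q b + Q c + Q (a + b + c) = Q (a + b) + Q (b + c) + Q (c + a)\<close>.
  In \<open>K\<^sub>4\<close> let \<open>a\<close>, \<open>b\<close>, \<open>c\<close> be the three triangles through a fixed vertex, coherently oriented. The
  three pairwise sums are the 4-cycles and the total sum is the remaining triangle, so all seven
  chains come from cycles. If \<open>tb\<close> were odd on all cycles, then a sum of four odd numbers would equal a
  sum of three odd numbers, which is absurd.

  A graph with a \<open>K\<^sub>4\<close> minor contains seven cycles with the same linear relations, because cycles
  lift through an edge contraction linearly: a cycle of the contracted graph becomes a cycle after
  possibly inserting the contracted edge, and the coefficient of that edge is forced by the vanishing
  of the boundary (\<open>cycle_chains_contract_edge\<close>).
\<close>

section \<open>Chains of cycles and edge contractions\<close>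

definition step_sign :: "'e \<times> bool \<Rightarrow> real" where
  "step_sign s = (if snd s then 1 else - 1)"

definition chain :: "('e \<times> bool) list \<Rightarrow> 'e \<Rightarrow> real" where
  "chain w e = (\<Sum>s\<leftarrow>w. if fst s = e then step_sign s else 0)"

definition cycle_chains :: "('v, 'e) pre_digraph \<Rightarrow> ('e \<Rightarrow> real) set" where
  "cycle_chains G = chain ` {w. cycle G w}"

text \<open>
  The relations among the seven cycles of \<open>K\<^sub>4\<close>, that is, among the four face boundaries and the three
  quadrilaterals of a tetrahedron.
\<close>

definition tetrahedral :: "('v, 'e) pre_digraph \<Rightarrow> bool" where
  "tetrahedral G \<longleftrightarrow>
     (\<exists>a b c. {a, b, c, a + b, b + c, c + a, a + b + c} \<subseteq> cycle_chains G)"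

lemma chain_append: "chain (u @ w) = chain u + chain w"
  by (simp add: chain_def fun_eq_iff)

lemma chain_notin: "e \<notin> fst ` set w \<Longrightarrow> chain w e = 0"
  unfolding chain_def by (induction w) auto

text \<open>
  Passing from sums over the steps of a walk to sums over edges weighted by the chain. It is used both
  for the boundary and, twice, for the Gauss integral.
\<close>

lemma sum_chain:
  fixes f :: "'e \<Rightarrow> real"
  assumes "finite A" "fst ` set w \<subseteq> A"
  shows "(\<Sum>e\<in>A. chain w e * f e) = (\<Sum>s\<leftarrow>w. step_sign s * f (fst s))"
  using assms(2)
proof (induction w)
  case Nil
  then show ?case by (simp add: chain_def)
next
  case (Cons s w)
  have "(\<Sum>e\<in>A. chain (s # w) e * f e)
      = (\<Sum>e\<in>A. if fst s = e then step_sign s * f e else 0) + (\<Sum>e\<in>A. chain w e * f e)"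
    unfolding sum.distrib[symmetric]
    by (intro sum.cong refl) (simp add: chain_def algebra_simps)
  then show ?case using Cons assms(1) by simp
qed

lemma cycle_rotate1:
  assumes "cycle G w" shows "cycle G (rotate1 w)"
proof -
  have len: "length w > 0" using assms by (simp add: cycle_def)
  have "step_end G (rotate1 w ! i) = step_start G (rotate1 w ! (Suc i mod length w))"
    if "i < length w" for i
  proof -
    have "step_end G (w ! (Suc i mod length w))
        = step_start G (w ! (Suc (Suc i mod length w) mod length w))"
      using assms len by (simp add: cycle_def)
    moreover have "Suc i mod length w < length w" using len by simp
    ultimately show ?thesis
      using that by (simp add: nth_rotate1)
  qed
  then show ?thesis
    using assms by (simp add: cycle_def distinct1_rotate rotate1_map[symmetric])
qed

lemma cycle_rotate: "cycle G w \<Longrightarrow> cycle G (rotate n w)"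
  by (induction n) (auto intro: cycle_rotate1)

lemma chain_rotate: "chain (rotate n w) = chain w"
proof (induction n)
  case (Suc n)
  have "chain (rotate1 u) = chain u" for u :: "('a \<times> bool) list"
    by (cases u) (auto simp: chain_append chain_def fun_eq_iff)
  with Suc show ?case by simp
qed simp

text \<open>
  The step ends are the step starts shifted by one, so each vertex is entered as often as it is left.
\<close>

lemma cycle_boundary:
  assumes "cycle G w" "finite A" "fst ` set w \<subseteq> A"
  shows "(\<Sum>e\<in>A. chain w e * (of_bool (head G e = x) - of_bool (tail G e = x))) = 0"
proof -
  let ?n = "length w"
  have n: "?n > 0" using assms(1) by (simp add: cycle_def)
  have "(\<Sum>e\<in>A. chain w e * (of_bool (head G e = x) - of_bool (tail G e = x)))
      = (\<Sum>s\<leftarrow>w. step_sign s * (of_bool (head G (fst s) = x) - of_bool (tail G (fst s) = x)))"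
    by (rule sum_chain[OF assms(2,3)])
  also have "\<dots> = (\<Sum>s\<leftarrow>w. of_bool (step_end G s = x) - of_bool (step_start G s = x))"
    by (intro arg_cong[where f = sum_list] map_cong refl)
      (simp add: step_sign_def step_start_def step_end_def)
  also have "\<dots> = (\<Sum>i<?n. of_bool (step_end G (w ! i) = x))
      - (\<Sum>i<?n. of_bool (step_start G (w ! i) = x))"
    by (simp add: sum_list_sum_nth atLeast0LessThan sum_subtractf)
  also have "(\<Sum>i<?n. of_bool (step_end G (w ! i) = x) :: real)
      = (\<Sum>i<?n. of_bool (step_start G (rotate1 w ! i) = x))"
    using assms(1) by (intro sum.cong refl) (simp add: cycle_def nth_rotate1)
  also have "\<dots> = (\<Sum>s\<leftarrow>rotate1 w. of_bool (step_start G s = x))"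
    by (simp add: sum_list_sum_nth atLeast0LessThan)
  also have "\<dots> = (\<Sum>s\<leftarrow>w. of_bool (step_start G s = x))"
    by (cases w) simp_all
  also have "\<dots> = (\<Sum>i<?n. of_bool (step_start G (w ! i) = x))"
    by (simp add: sum_list_sum_nth atLeast0LessThan)
  finally show ?thesis by simp
qed

text \<open>
  In \<open>G\<close> consecutive steps of the walk can fail to match only where the walk passes through the merged
  vertex, by arriving at one end of \<open>e\<close> and leaving from the other. As the walk visits the merged
  vertex once, there is at most one such place, and inserting \<open>e\<close> there repairs the walk. Rotating the
  cycle moves that place to the end of the list, so that the insertion becomes an append.
\<close>

lemma cycle_contract_edge_lift:
  assumes e: "e \<in> arcs G" and w: "cycle (contract_edge G e) w"
  shows "cycle G w \<or>
    (tail G e \<noteq> head G e \<and> (\<exists>n s. fst s = e \<and> cycle G (rotate n w @ [s])))"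
proof (cases "cycle G w")
  case False
  define q where "q x = (if x = head G e then tail G e else x)" for x
  let ?H = "contract_edge G e"
  have start: "step_start ?H s = q (step_start G s)" and fin: "step_end ?H s = q (step_end G s)" for s
    by (simp_all add: step_start_def step_end_def contract_edge_def Let_def q_def)
  have arcs: "arcs ?H = arcs G - {e}" by (simp add: contract_edge_def Let_def)
  have lift_dist: "distinct (map (step_start G) u)" if "distinct (map (step_start ?H) u)" for u
    using that by (auto simp: distinct_map inj_on_def start)
  obtain i where i: "i < length w" "step_end G (w ! i) \<noteq> step_start G (w ! (Suc i mod length w))"
    using False w lift_dist[of w] unfolding cycle_def arcs by auto
  define u where "u = rotate (Suc i) w"
  have u: "cycle ?H u" unfolding u_def by (rule cycle_rotate[OF w])
  have len: "length u = length w" "u \<noteq> []" using i by (auto simp: u_def)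
  have hd_u: "hd u = w ! (Suc i mod length w)"
    using i unfolding u_def by (subst hd_rotate_conv_nth) auto
  have last_u: "last u = w ! i"
  proof -
    have "last u = rotate (Suc i) w ! (length w - 1)"
      using len by (simp add: last_conv_nth u_def)
    also have "\<dots> = w ! ((Suc i + (length w - 1)) mod length w)"
      using i by (subst nth_rotate) auto
    also have "Suc i + (length w - 1) = i + length w" using i by simp
    finally show ?thesis using i by simp
  qed
  let ?a = "step_end G (last u)" and ?b = "step_start G (hd u)"
  have ab: "?a \<noteq> ?b" using i by (simp add: hd_u last_u)
  have qab: "q ?a = q ?b"
  proof -
    have "step_end ?H (w ! i) = step_start ?H (w ! (Suc i mod length w))"
      using w i by (auto simp: cycle_def)
    then show ?thesis by (simp add: start fin hd_u last_u)
  qed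
  then have ab_cases: "?a = tail G e \<and> ?b = head G e \<or> ?a = head G e \<and> ?b = tail G e"
    using ab by (auto simp: q_def split: if_splits)
  define s where "s = (e, ?a = tail G e)"
  have s: "step_start G s = ?a" "step_end G s = ?b"
    using ab ab_cases by (auto simp: s_def step_start_def step_end_def)
  \<comment> \<open>A second mismatch would be a second visit to the merged vertex, which is the start of \<open>u\<close>.\<close>
  have inner: "step_end G (u ! k) = step_start G (u ! Suc k)" if k: "Suc k < length u" for k
  proof (rule ccontr)
    assume neq: "step_end G (u ! k) \<noteq> step_start G (u ! Suc k)"
    have "q (step_end G (u ! k)) = q (step_start G (u ! Suc k))"
      using u k by (auto simp: cycle_def start fin dest: spec[of _ k])
    then have "q (step_start G (u ! Suc k)) = tail G e"
      using neq by (auto simp: q_def split: if_splits)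
    moreover have "q (step_start G (u ! 0)) = tail G e"
      using ab_cases len by (auto simp: q_def hd_conv_nth)
    ultimately have "map (step_start ?H) u ! Suc k = map (step_start ?H) u ! 0"
      using k len(2) by (simp add: start)
    moreover have "distinct (map (step_start ?H) u)" using u by (simp add: cycle_def)
    ultimately have "Suc k = 0"
      using k len(2) nth_eq_iff_index_eq[of "map (step_start ?H) u" "Suc k" 0] by simp
    then show False by simp
  qed
  \<comment> \<open>The end of \<open>e\<close> from which the inserted step starts is merged with the start of \<open>u\<close>, so no other step uses it.\<close>
  have a_new: "?a \<notin> step_start G ` set u"
  proof
    assume "?a \<in> step_start G ` set u"
    then obtain r where r: "r \<in> set u" "step_start G r = ?a" by auto
    have "step_start ?H r = step_start ?H (hd u)" using r qab by (simp add: start)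
    moreover have "inj_on (step_start ?H) (set u)" using u by (simp add: cycle_def distinct_map)
    ultimately have "r = hd u" using r len by (meson hd_in_set inj_onD)
    then show False using r ab by simp
  qed
  have "cycle G (u @ [s])"
    unfolding cycle_def
  proof (intro conjI allI impI)
    have sub: "fst ` set u \<subseteq> arcs G - {e}" using u by (simp add: cycle_def arcs)
    show "fst ` set (u @ [s]) \<subseteq> arcs G" using sub e by (auto simp: s_def)
    show "distinct (map fst (u @ [s]))" using sub u by (auto simp: s_def cycle_def)
    show "distinct (map (step_start G) (u @ [s]))"
      using a_new lift_dist[of u] u by (auto simp: s cycle_def)
    fix k assume "k < length (u @ [s])"
    then consider "Suc k < length u" | "Suc k = length u" | "k = length u" by fastforce
    then show "step_end G ((u @ [s]) ! k) = step_start G ((u @ [s]) ! (Suc k mod length (u @ [s])))"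
    proof cases
      case 1
      then show ?thesis using inner by (simp add: nth_append)
    next
      case 2
      then have "length u - 1 = k" by simp
      then have "last u = u ! k" using len(2) by (simp add: last_conv_nth)
      moreover have "k < length u" using 2 by simp
      ultimately show ?thesis using 2 s by (simp add: nth_append)
    next
      case 3
      then show ?thesis using s len(2) by (simp add: nth_append hd_conv_nth)
    qed
  qed simp
  moreover have "tail G e \<noteq> head G e" using ab ab_cases by auto
  moreover have "fst s = e" by (simp add: s_def)
  ultimately show ?thesis unfolding u_def by blast
qed simp

text \<open>
  The lifted chain agrees with the given one away from \<open>e\<close>. If \<open>e\<close> is not a loop, its coefficient is
  determined by the boundary at the head of \<open>e\<close>, which is a linear condition; if \<open>e\<close> is a loop, the
  contraction deletes it and the coefficient is 0. So lifting is given by an additive map, and all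
  linear relations between cycles survive.
\<close>

lemma cycle_chains_contract_edge:
  fixes G :: "('v, 'e) pre_digraph"
  assumes fin: "finite (arcs G)" and e: "e \<in> arcs G"
  shows "\<exists>\<Lambda>. Modules.additive \<Lambda> \<and> \<Lambda> ` cycle_chains (contract_edge G e) \<subseteq> cycle_chains G"
proof -
  let ?H = "contract_edge G e" and ?A = "arcs G - {e}"
  \<comment> \<open>\<open>d f\<close> is the coefficient of the head of \<open>e\<close> in the boundary of the edge \<open>f\<close>; for a non-loop, \<open>d e = 1\<close>.\<close>
  define d where "d f = (of_bool (head G f = head G e) - of_bool (tail G f = head G e) :: real)" for f
  define \<Lambda> :: "('e \<Rightarrow> real) \<Rightarrow> 'e \<Rightarrow> real" where
    "\<Lambda> x = (\<lambda>h. if h \<noteq> e then x h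
       else if tail G e = head G e then 0 else - (\<Sum>f\<in>?A. x f * d f))" for x
  have "Modules.additive \<Lambda>"
    by (rule Modules.additive.intro) (auto simp: \<Lambda>_def fun_eq_iff algebra_simps sum.distrib)
  moreover have "\<Lambda> (chain w) \<in> cycle_chains G" if w: "cycle ?H w" for w
  proof -
    have wA: "fst ` set w \<subseteq> ?A" using w by (simp add: cycle_def contract_edge_def Let_def)
    obtain w' where w': "cycle G w'" "\<And>f. f \<noteq> e \<Longrightarrow> chain w' f = chain w f"
      "tail G e = head G e \<Longrightarrow> w' = w"
    proof -
      from cycle_contract_edge_lift[OF e w] show thesis
      proof (elim disjE conjE exE)
        assume "cycle G w" then show thesis by (rule that) simp_all
      next
        fix n s assume *: "tail G e \<noteq> head G e" "fst s = e" "cycle G (rotate n w @ [s])"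
        have "chain (rotate n w @ [s]) f = chain w f" if "f \<noteq> e" for f
          using that *(2) by (simp add: chain_append chain_rotate chain_notin[of f "[s]"])
        with * show thesis by (intro that[of "rotate n w @ [s]"]) auto
      qed
    qed
    have "chain w' e = \<Lambda> (chain w) e"
    proof (cases "tail G e = head G e")
      case True
      then show ?thesis using w'(3) wA chain_notin[of e w] by (auto simp: \<Lambda>_def)
    next
      case False
      have "fst ` set w' \<subseteq> arcs G" using w'(1) by (simp add: cycle_def)
      from cycle_boundary[OF w'(1) fin this, of "head G e"]
      have "0 = (\<Sum>f\<in>arcs G. chain w' f * d f)" by (simp add: d_def)
      also have "\<dots> = chain w' e * d e + (\<Sum>f\<in>?A. chain w' f * d f)"
        by (rule sum.remove[OF fin e])
      also have "(\<Sum>f\<in>?A. chain w' f * d f) = (\<Sum>f\<in>?A. chain w f * d f)"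
        by (intro sum.cong refl) (simp add: w'(2))
      finally show ?thesis using False by (simp add: \<Lambda>_def d_def)
    qed
    then have "chain w' = \<Lambda> (chain w)" using w'(2) by (auto simp: \<Lambda>_def fun_eq_iff)
    then show ?thesis using w'(1) by (auto simp: cycle_chains_def intro!: image_eqI[of _ _ w'])
  qed
  ultimately show ?thesis by (auto simp: cycle_chains_def)
qed

lemma tetrahedral_contract_edge:
  assumes "finite (arcs G)" "e \<in> arcs G" "tetrahedral (contract_edge G e)"
  shows "tetrahedral G"
proof -
  obtain \<Lambda> where \<Lambda>: "Modules.additive \<Lambda>" "\<Lambda> ` cycle_chains (contract_edge G e) \<subseteq> cycle_chains G"
    using cycle_chains_contract_edge[OF assms(1,2)] by blast
  obtain a b c where "{a, b, c, a + b, b + c, c + a, a + b + c} \<subseteq> cycle_chains (contract_edge G e)"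
    using assms(3) unfolding tetrahedral_def by blast
  then have "\<Lambda> ` {a, b, c, a + b, b + c, c + a, a + b + c} \<subseteq> cycle_chains G"
    using \<Lambda>(2) by blast
  then have "{\<Lambda> a, \<Lambda> b, \<Lambda> c, \<Lambda> a + \<Lambda> b, \<Lambda> b + \<Lambda> c, \<Lambda> c + \<Lambda> a, \<Lambda> a + \<Lambda> b + \<Lambda> c}
      \<subseteq> cycle_chains G"
    by (simp add: Modules.additive.add[OF \<Lambda>(1)])
  then show ?thesis unfolding tetrahedral_def by blast
qed

lemma wf_contract_edge: "wf_digraph G \<Longrightarrow> wf_digraph (contract_edge G e)"
  by (auto simp: wf_digraph_def contract_edge_def Let_def)

lemma tetrahedral_contracts_to:
  assumes "contracts_to\<^sup>*\<^sup>* S T" "finite (arcs S)" "wf_digraph S"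
  shows "wf_digraph T \<and> finite (arcs T) \<and> (tetrahedral T \<longrightarrow> tetrahedral S)"
  using assms(1)
proof (induction rule: rtranclp_induct)
  case (step T U)
  then obtain e where e: "e \<in> arcs T" "U = contract_edge T e"
    by (auto simp: contracts_to_def)
  have "finite (arcs U)" using step e by (simp add: contract_edge_def Let_def)
  moreover have "wf_digraph U" using step e by (simp add: wf_contract_edge)
  moreover have "tetrahedral U \<longrightarrow> tetrahedral T" using step e tetrahedral_contract_edge[of T e] by simp
  ultimately show ?case using step by simp
qed (use assms in auto)

lemma tetrahedral_subgraph:
  assumes "subgraph S G" "tetrahedral S" shows "tetrahedral G"
proof -
  have "cycle G w" if "cycle S w" for w
  proof -
    have "step_start G = step_start S" "step_end G = step_end S"
      using assms(1) by (auto simp: subgraph_def compatible_def step_start_def step_end_def fun_eq_iff)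
    then show ?thesis using that assms(1) by (auto simp: cycle_def subgraph_def)
  qed
  then have "cycle_chains S \<subseteq> cycle_chains G" by (auto simp: cycle_chains_def)
  then show ?thesis using assms(2) unfolding tetrahedral_def by blast
qed

text \<open>
  An isomorphism of undirected graphs need not respect the reference orientations of the edges, so the
  edges are handled through the steps \<open>st i j\<close> from the \<open>i\<close>-th to the \<open>j\<close>-th vertex. Reversing such a
  step negates its chain, which makes the spokes cancel in the sums of the triangles.
\<close>

lemma tetrahedral_complete_graph_4:
  assumes wf: "wf_digraph T" and iso: "ugraph_isomorphic T (complete_graph 4)"
  shows "tetrahedral T"
proof -
  obtain \<phi> \<psi> where \<phi>: "bij_betw \<phi> (verts T) {..<4::nat}"
    and \<psi>: "bij_betw \<psi> (arcs T) {(i, j). i < j \<and> j < (4::nat)}"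
    and ends: "\<And>e. e \<in> arcs T \<Longrightarrow> {fst (\<psi> e), snd (\<psi> e)} = \<phi> ` {tail T e, head T e}"
    using iso unfolding ugraph_isomorphic_def complete_graph_def ends_def by auto
  define E where "E i j = inv_into (arcs T) \<psi> (min i j, max i j)" for i j :: nat
  define x where "x i = inv_into (verts T) \<phi> i" for i :: nat
  define st where "st i j = (E i j, tail T (E i j) = x i)" for i j
  have E: "E i j \<in> arcs T" "\<psi> (E i j) = (min i j, max i j)" if "i < 4" "j < 4" "i \<noteq> j" for i j
  proof -
    have "(min i j, max i j) \<in> {(i, j). i < j \<and> j < (4::nat)}"
      using that by (auto simp: min_def max_def)
    then have "(min i j, max i j) \<in> \<psi> ` arcs T" using \<psi> by (simp add: bij_betw_def)
    then show "E i j \<in> arcs T" "\<psi> (E i j) = (min i j, max i j)"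
      unfolding E_def by (rule inv_into_into, rule f_inv_into_f)
  qed
  have pair: "{min m n, max m n} = {m, n}" for m n :: nat by (auto simp: min_def max_def)
  have E_commute: "E i j = E j i" for i j by (simp add: E_def min.commute max.commute)
  have E_neq: "E i j \<noteq> E k l"
    if "i < 4" "j < 4" "i \<noteq> j" "k < 4" "l < 4" "k \<noteq> l" "{i, j} \<noteq> {k, l}" for i j k l
  proof
    assume "E i j = E k l"
    then have "(min i j, max i j) = (min k l, max k l)"
      using E(2)[OF that(1-3)] E(2)[OF that(4-6)] by simp
    then show False using pair[of i j] pair[of k l] that(7) by simp
  qed
  have x: "x i \<in> verts T" "\<phi> (x i) = i" if "i < 4" for i
  proof -
    have "i \<in> \<phi> ` verts T" using that \<phi> by (simp add: bij_betw_def)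
    then show "x i \<in> verts T" "\<phi> (x i) = i"
      unfolding x_def by (rule inv_into_into, rule f_inv_into_f)
  qed
  have x_eq: "x (\<phi> v) = v" if "v \<in> verts T" for v
    using that \<phi> unfolding x_def bij_betw_def by simp
  have x_neq: "x i \<noteq> x j" if "i < 4" "j < 4" "i \<noteq> j" for i j using x that by metis
  have E_ends: "{tail T (E i j), head T (E i j)} = {x i, x j}"
    if ij: "i < 4" "j < 4" "i \<noteq> j" for i j
  proof -
    let ?e = "E i j"
    have v: "tail T ?e \<in> verts T" "head T ?e \<in> verts T"
      using wf E(1)[OF ij] by (auto simp: wf_digraph_def)
    then have "{tail T ?e, head T ?e} = x ` \<phi> ` {tail T ?e, head T ?e}"
      by (simp add: x_eq)
    also have "\<phi> ` {tail T ?e, head T ?e} = {i, j}"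
      using ends[OF E(1)[OF ij]] E(2)[OF ij] pair[of i j] by simp
    finally show ?thesis by simp
  qed
  have st: "step_start T (st i j) = x i" "step_end T (st i j) = x j" "fst (st i j) \<in> arcs T"
    if ij: "i < 4" "j < 4" "i \<noteq> j" for i j
    using E_ends[OF ij] x_neq[OF ij] E(1)[OF ij]
    by (auto simp: st_def step_start_def step_end_def doubleton_eq_iff)
  have st_rev: "chain [st j i] = - chain [st i j]" if ij: "i < 4" "j < 4" "i \<noteq> j" for i j
    using E_ends[OF ij] x_neq[OF ij] E_commute[of j i]
    by (auto simp: fun_eq_iff chain_def st_def step_sign_def doubleton_eq_iff)
  have st_eq_iff: "fst (st i j) = fst (st k l) \<longleftrightarrow> {i, j} = {k, l}"
    if "i < 4" "j < 4" "i \<noteq> j" "k < 4" "l < 4" "k \<noteq> l" for i j k l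
    using E_neq[OF that] E_commute by (auto simp: st_def doubleton_eq_iff)
  have x_eq_iff: "x i = x j \<longleftrightarrow> i = j" if "i < 4" "j < 4" for i j
    using x_neq[OF that] by blast
  have triangle: "chain [st i j] + chain [st j k] + chain [st k i] \<in> cycle_chains T"
    if "i < 4" "j < 4" "k < 4" "distinct [i, j, k]" for i j k
  proof -
    have "j \<noteq> i" "k \<noteq> i" "k \<noteq> j" using that by auto
    then have "cycle T [st i j, st j k, st k i]"
      unfolding cycle_def using that
      by (simp add: st x_eq_iff st_eq_iff doubleton_eq_iff All_less_Suc)
    moreover have "chain [st i j, st j k, st k i] = chain [st i j] + chain [st j k] + chain [st k i]"
      by (simp add: chain_def fun_eq_iff)
    ultimately show ?thesis unfolding cycle_chains_def by (metis image_eqI mem_Collect_eq)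
  qed
  have square: "chain [st i j] + chain [st j k] + chain [st k l] + chain [st l i] \<in> cycle_chains T"
    if "i < 4" "j < 4" "k < 4" "l < 4" "distinct [i, j, k, l]" for i j k l
  proof -
    \<comment> \<open>Linear arithmetic would split exponentially many cases on these disequations, hence the limit.\<close>
    have "j \<noteq> i" "k \<noteq> i" "k \<noteq> j" "l \<noteq> i" "l \<noteq> j" "l \<noteq> k" using that by auto
    then have "cycle T [st i j, st j k, st k l, st l i]"
      unfolding cycle_def using that [[linarith_neq_limit = 0]]
      by (simp add: st x_eq_iff st_eq_iff doubleton_eq_iff All_less_Suc)
    moreover have "chain [st i j, st j k, st k l, st l i]
        = chain [st i j] + chain [st j k] + chain [st k l] + chain [st l i]"
      by (simp add: chain_def fun_eq_iff)
    ultimately show ?thesis unfolding cycle_chains_def by (metis image_eqI mem_Collect_eq)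
  qed
  define a b c where
    "a = chain [st 0 1] + chain [st 1 2] + chain [st 2 0]" and
    "b = chain [st 0 2] + chain [st 2 3] + chain [st 3 0]" and
    "c = chain [st 0 3] + chain [st 3 1] + chain [st 1 0]"
  have "a \<in> cycle_chains T" "b \<in> cycle_chains T" "c \<in> cycle_chains T"
    unfolding a_def b_def c_def by (rule triangle; simp)+
  moreover have "a + b \<in> cycle_chains T"
    using square[of 0 1 2 3] st_rev[of 0 2] by (simp add: a_def b_def algebra_simps)
  moreover have "b + c \<in> cycle_chains T"
    using square[of 0 2 3 1] st_rev[of 0 3] by (simp add: b_def c_def algebra_simps)
  moreover have "c + a \<in> cycle_chains T"
    using square[of 0 3 1 2] st_rev[of 0 1] by (simp add: c_def a_def algebra_simps)
  moreover have "a + b + c \<in> cycle_chains T"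
    using triangle[of 1 2 3] st_rev[of 0 1] st_rev[of 0 2] st_rev[of 0 3]
    by (simp add: a_def b_def c_def algebra_simps)
  ultimately show ?thesis unfolding tetrahedral_def by blast
qed

theorem tetrahedral_if_minor_complete_graph_4:
  assumes "fin_digraph G" "minor (complete_graph 4) G"
  shows "tetrahedral G"
proof -
  obtain S T where S: "subgraph S G" and T: "contracts_to\<^sup>*\<^sup>* S T"
    and iso: "ugraph_isomorphic T (complete_graph 4)"
    using assms(2) unfolding minor_def by blast
  have "finite (arcs S)"
    using S assms(1) by (meson fin_digraph.finite_arcs finite_subset subgraph_def)
  moreover have "wf_digraph S" using S by (simp add: subgraph_def)
  ultimately show ?thesis
    using tetrahedral_contracts_to[OF T] tetrahedral_complete_graph_4[OF _ iso]
      tetrahedral_subgraph[OF S] by blast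
qed

section \<open>Quadratic forms on chains\<close>

definition quadratic_form :: "'e set \<Rightarrow> ('e \<Rightarrow> 'e \<Rightarrow> real) \<Rightarrow> ('e \<Rightarrow> real) \<Rightarrow> real" where
  "quadratic_form A j x = (\<Sum>e\<in>A. \<Sum>f\<in>A. x e * x f * j e f)"

text \<open>
  This is the vanishing of the third difference of a function of degree 2 without constant term.
\<close>

lemma quadratic_form_polarization:
  "quadratic_form A j a + quadratic_form A j b + quadratic_form A j c + quadratic_form A j (a + b + c)
    = quadratic_form A j (a + b) + quadratic_form A j (b + c) + quadratic_form A j (c + a)"
  unfolding quadratic_form_def sum.distrib[symmetric]
  by (intro sum.cong refl) (simp add: algebra_simps)

section \<open>Line integrals\<close>

text \<open>
  The derivative is one-sided at the end points and continuous on the closed interval, hence bounded.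
  This is what makes the integrands below integrable; continuous differentiability off a finite set
  would not suffice.
\<close>

definition C1_arc :: "(real \<Rightarrow> 'a::real_normed_vector) \<Rightarrow> bool" where
  "C1_arc g \<longleftrightarrow> (\<exists>g'. continuous_on {0..1} g' \<and>
     (\<forall>t\<in>{0..1}. (g has_vector_derivative g' t) (at t within {0..1})))"

text \<open>
  Integration of a form \<open>L\<close> that depends on a point and, linearly, on a tangent vector. Both integrals
  in the Gauss integral have this shape, the inner one with vector values.
\<close>

definition line_integral ::
  "('a::real_normed_vector \<Rightarrow> 'a \<Rightarrow> 'b::real_normed_vector) \<Rightarrow> (real \<Rightarrow> 'a) \<Rightarrow> 'b" where
  "line_integral L g = integral {0..1} (\<lambda>t. L (g t) (vector_derivative g (at t)))"

text \<open>
  A concatenation has no derivative at its corners. Carrying a derivative \<open>g'\<close> off a finite set along with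
  the value makes the notion stable under concatenation and reversal.
\<close>

definition has_line_integral ::
  "('a::real_normed_vector \<Rightarrow> 'a \<Rightarrow> 'b::real_normed_vector) \<Rightarrow> (real \<Rightarrow> 'a) \<Rightarrow> 'b \<Rightarrow> bool" where
  "has_line_integral L g I \<longleftrightarrow>
     (\<exists>g' F. finite F \<and> (\<forall>t\<in>{0..1} - F. (g has_vector_derivative g' t) (at t)) \<and>
        ((\<lambda>t. L (g t) (g' t)) has_integral I) {0..1})"

lemma has_line_integralD:
  assumes "has_line_integral L g I"
  shows "((\<lambda>t. L (g t) (vector_derivative g (at t))) has_integral I) {0..1}"
proof -
  obtain g' F where F: "finite F" and g': "\<And>t. t \<in> {0..1} - F \<Longrightarrow> (g has_vector_derivative g' t) (at t)"
    and I: "((\<lambda>t. L (g t) (g' t)) has_integral I) {0..1}"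
    using assms unfolding has_line_integral_def by blast
  have "L (g t) (vector_derivative g (at t)) = L (g t) (g' t)" if "t \<in> {0..1} - F" for t
    using vector_derivative_at[OF g'[OF that]] by simp
  then show ?thesis by (rule has_integral_spike_finite[OF F _ I])
qed

lemma line_integral_unique: "has_line_integral L g I \<Longrightarrow> line_integral L g = I"
  unfolding line_integral_def by (rule integral_unique[OF has_line_integralD])

lemma C1_arc_imp_continuous: "C1_arc g \<Longrightarrow> continuous_on {0..1} g"
  unfolding C1_arc_def
  by (metis continuous_on_eq_continuous_within has_vector_derivative_continuous)

lemma C1_arc_line_integral:
  fixes L :: "'a::real_normed_vector \<Rightarrow> 'a \<Rightarrow> 'b::euclidean_space"
  assumes g: "C1_arc g" and L: "continuous_on (path_image g \<times> UNIV) (\<lambda>(x, u). L x u)"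
  shows "has_line_integral L g (line_integral L g)"
proof -
  obtain g' where cont: "continuous_on {0..1} g'"
    and g': "\<And>t. t \<in> {0..1} \<Longrightarrow> (g has_vector_derivative g' t) (at t within {0..1})"
    using g unfolding C1_arc_def by blast
  have "continuous_on {0..1} ((\<lambda>(x, u). L x u) \<circ> (\<lambda>t. (g t, g' t)))"
    by (intro continuous_on_compose continuous_on_Pair cont C1_arc_imp_continuous[OF g]
        continuous_on_subset[OF L]) (auto simp: path_image_def)
  then have "continuous_on {0..1} (\<lambda>t. L (g t) (g' t))" by (simp add: o_def)
  then obtain I where "((\<lambda>t. L (g t) (g' t)) has_integral I) {0..1}"
    using integrable_continuous_interval by blast
  moreover have "(g has_vector_derivative g' t) (at t)" if "t \<in> {0..1} - {0, 1}" for t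
    using g'[of t] that at_within_Icc_at[of 0 t 1] by auto
  ultimately have "has_line_integral L g I"
    unfolding has_line_integral_def by (intro exI[of _ g'] exI[of _ "{0, 1}"]) auto
  then show ?thesis using line_integral_unique by metis
qed

lemma has_line_integral_join:
  fixes L :: "'a::real_normed_vector \<Rightarrow> 'a \<Rightarrow> 'b::banach"
  assumes 1: "has_line_integral L g1 I1" and 2: "has_line_integral L g2 I2"
    and L: "\<And>x. linear (L x)"
  shows "has_line_integral L (g1 +++ g2) (I1 + I2)"
proof -
  obtain d1 F1 where F1: "finite F1"
    and d1: "\<And>t. t \<in> {0..1} - F1 \<Longrightarrow> (g1 has_vector_derivative d1 t) (at t)"
    and i1: "((\<lambda>t. L (g1 t) (d1 t)) has_integral I1) {0..1}"
    using 1 unfolding has_line_integral_def by blast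
  obtain d2 F2 where F2: "finite F2"
    and d2: "\<And>t. t \<in> {0..1} - F2 \<Longrightarrow> (g2 has_vector_derivative d2 t) (at t)"
    and i2: "((\<lambda>t. L (g2 t) (d2 t)) has_integral I2) {0..1}"
    using 2 unfolding has_line_integral_def by blast
  let ?g = "g1 +++ g2"
  define d where "d t = (if t < 1/2 then 2 *\<^sub>R d1 (2 * t) else 2 *\<^sub>R d2 (2 * t - 1))" for t
  define F where "F = {1/2} \<union> (\<lambda>t. t / 2) ` F1 \<union> (\<lambda>t. (t + 1) / 2) ` F2"
  have "finite F" unfolding F_def using F1 F2 by auto
  moreover have "(?g has_vector_derivative d t) (at t)" if t: "t \<in> {0..1} - F" for t
  proof (cases "t < 1/2")
    case True
    have "2 * t \<notin> F1"
    proof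
      assume "2 * t \<in> F1"
      then have "(2 * t) / 2 \<in> F" unfolding F_def by blast
      then show False using t by simp
    qed
    then have "2 * t \<in> {0..1} - F1" using t True by auto
    then have "((g1 \<circ> (\<lambda>t. 2 * t)) has_vector_derivative (2 *\<^sub>R d1 (2 * t))) (at t)"
      by (intro vector_diff_chain_at d1) (auto intro!: derivative_eq_intros)
    then have "(?g has_vector_derivative (2 *\<^sub>R d1 (2 * t))) (at t)"
      by (rule has_vector_derivative_transform_within_open[of _ _ _ "{..<1/2}"])
        (use True in \<open>auto simp: joinpaths_def\<close>)
    then show ?thesis using True by (simp add: d_def)
  next
    case False
    then have gt: "t > 1/2" using t by (auto simp: F_def)
    have "2 * t - 1 \<notin> F2"
    proof
      assume "2 * t - 1 \<in> F2"
      then have "((2 * t - 1) + 1) / 2 \<in> F" unfolding F_def by blast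
      then show False using t by simp
    qed
    then have "2 * t - 1 \<in> {0..1} - F2" using t gt by auto
    then have "((g2 \<circ> (\<lambda>t. 2 * t - 1)) has_vector_derivative (2 *\<^sub>R d2 (2 * t - 1))) (at t)"
      by (intro vector_diff_chain_at d2) (auto intro!: derivative_eq_intros)
    then have "(?g has_vector_derivative (2 *\<^sub>R d2 (2 * t - 1))) (at t)"
      by (rule has_vector_derivative_transform_within_open[of _ _ _ "{1/2<..}"])
        (use gt in \<open>auto simp: joinpaths_def\<close>)
    then show ?thesis using False by (simp add: d_def)
  qed
  moreover have "((\<lambda>t. L (?g t) (d t)) has_integral (I1 + I2)) {0..1}"
  proof (rule has_integral_combine[where a = 0 and c = "1/2" and b = 1])
    have "((\<lambda>t. L (g1 (2 * t + 0)) (d1 (2 * t + 0))) has_integral (1/2) *\<^sub>R I1) {0..1/2}"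
      using has_integral_affinity'[of "\<lambda>t. L (g1 t) (d1 t)" I1 0 "1::real" 2 0] i1 by simp
    then have "((\<lambda>t. 2 *\<^sub>R L (g1 (2 * t)) (d1 (2 * t))) has_integral I1) {0..1/2}"
      using has_integral_cmul[of _ "(1/2) *\<^sub>R I1" _ 2] by simp
    then show "((\<lambda>t. L (?g t) (d t)) has_integral I1) {0..1/2}"
      by (rule has_integral_spike_finite[of "{1/2}", rotated 2])
        (auto simp: joinpaths_def d_def linear_cmul[OF L])
    have "((\<lambda>t. L (g2 (2 * t + -1)) (d2 (2 * t + -1))) has_integral (1/2) *\<^sub>R I2) {1/2..1}"
      using has_integral_affinity'[of "\<lambda>t. L (g2 t) (d2 t)" I2 0 "1::real" 2 "-1"] i2 by simp
    then have "((\<lambda>t. 2 *\<^sub>R L (g2 (2 * t - 1)) (d2 (2 * t - 1))) has_integral I2) {1/2..1}"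
      using has_integral_cmul[of _ "(1/2) *\<^sub>R I2" _ 2] by simp
    then show "((\<lambda>t. L (?g t) (d t)) has_integral I2) {1/2..1}"
      by (rule has_integral_spike_finite[of "{1/2}", rotated 2])
        (auto simp: joinpaths_def d_def linear_cmul[OF L])
  qed auto
  ultimately show ?thesis unfolding has_line_integral_def by blast
qed

lemma has_line_integral_reversepath:
  assumes 1: "has_line_integral L g I" and L: "\<And>x. linear (L x)"
  shows "has_line_integral L (reversepath g) (- I)"
proof -
  obtain d F where F: "finite F"
    and d: "\<And>t. t \<in> {0..1} - F \<Longrightarrow> (g has_vector_derivative d t) (at t)"
    and i: "((\<lambda>t. L (g t) (d t)) has_integral I) {0..1}"
    using 1 unfolding has_line_integral_def by blast
  have "(reversepath g has_vector_derivative - d (1 - t)) (at t)"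
    if "t \<in> {0..1} - (\<lambda>t. 1 - t) ` F" for t
  proof -
    have "1 - t \<in> {0..1} - F" using that by (force simp: image_iff)
    then have "((g \<circ> (\<lambda>t. 1 - t)) has_vector_derivative ((-1) *\<^sub>R d (1 - t))) (at t)"
      by (intro vector_diff_chain_at d) (auto intro!: derivative_eq_intros)
    then show ?thesis by (simp add: reversepath_def o_def)
  qed
  moreover have "((\<lambda>t. L (reversepath g t) (- d (1 - t))) has_integral - I) {0..1}"
  proof -
    have "((\<lambda>t. L (g (-1 * t + 1)) (d (-1 * t + 1))) has_integral I) {0..1}"
      using has_integral_affinity[of "\<lambda>t. L (g t) (d t)" I 0 "1::real" "-1" 1] i by simp
    then show ?thesis
      using has_integral_neg by (simp add: reversepath_def linear_neg[OF L]) 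
  qed
  ultimately show ?thesis
    unfolding has_line_integral_def using F by (intro exI[of _ "\<lambda>t. - d (1 - t)"]) blast
qed

lemma smooth_on_imp_C1_arc:
  assumes "smooth_on {0..1} c" shows "C1_arc c"
proof -
  obtain D where D: "D 0 = c"
    "\<And>n t. t \<in> {0..1} \<Longrightarrow> (D n has_vector_derivative D (Suc n) t) (at t within {0..1})"
    using assms unfolding smooth_on_def by blast
  have "continuous_on {0..1} (D 1)"
    using D(2)[of _ 1] has_vector_derivative_continuous
    unfolding continuous_on_eq_continuous_within by blast
  then show ?thesis
    unfolding C1_arc_def using D(2)[of _ 0] D(1) by (intro exI[of _ "D 1"]) simp
qed

lemma C1_arc_push_off:
  assumes c: "C1_arc c" and v: "transverse_field v"
  shows "C1_arc (\<lambda>t. c t + \<epsilon> *\<^sub>R v (c t))"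
proof -
  obtain c' where cont: "continuous_on {0..1} c'"
    and c': "\<And>t. t \<in> {0..1} \<Longrightarrow> (c has_vector_derivative c' t) (at t within {0..1})"
    using c unfolding C1_arc_def by blast
  obtain v' where v': "continuous_on UNIV v'" "\<And>p. (v has_derivative blinfun_apply (v' p)) (at p)"
    using v unfolding transverse_field_def by blast
  have "((\<lambda>t. c t + \<epsilon> *\<^sub>R v (c t)) has_vector_derivative
      (c' t + \<epsilon> *\<^sub>R blinfun_apply (v' (c t)) (c' t))) (at t within {0..1})" if "t \<in> {0..1}" for t
  proof -
    have "((v \<circ> c) has_derivative (blinfun_apply (v' (c t)) \<circ> (\<lambda>h. h *\<^sub>R c' t))) (at t within {0..1})"
      by (rule diff_chain_within[OF c'[OF that, unfolded has_vector_derivative_def]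
            has_derivative_at_withinI[OF v'(2)]])
    then have "((\<lambda>t. v (c t)) has_vector_derivative blinfun_apply (v' (c t)) (c' t)) (at t within {0..1})"
      by (simp add: has_vector_derivative_def o_def blinfun.scaleR_right)
    with c'[OF that] show ?thesis by (auto intro!: derivative_eq_intros)
  qed
  moreover have "continuous_on {0..1} (\<lambda>t. c' t + \<epsilon> *\<^sub>R blinfun_apply (v' (c t)) (c' t))"
    by (intro continuous_intros cont continuous_on_compose2[OF v'(1)] C1_arc_imp_continuous[OF c]) auto
  ultimately show ?thesis unfolding C1_arc_def by blast
qed

section \<open>The Gauss integral along walks\<close>

text \<open>
  Up to the factor \<open>1 / (4 * pi)\<close>, the Biot--Savart law for the magnetic field at \<open>x\<close> of a unit current
  through \<open>d\<close>. The Gauss integral of \<open>c\<close> and \<open>d\<close> is the circulation along \<open>c\<close> of the field of \<open>d\<close>, which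
  splits it into two line integrals.
\<close>

definition biot_savart_form :: "real^3 \<Rightarrow> real^3 \<Rightarrow> real^3 \<Rightarrow> real^3" where
  "biot_savart_form x y u = cross3 u (x - y) /\<^sub>R norm (x - y) ^ 3"

definition biot_savart :: "(real \<Rightarrow> real^3) \<Rightarrow> real^3 \<Rightarrow> real^3" where
  "biot_savart d x = line_integral (biot_savart_form x) d"

lemma linear_biot_savart_form: "linear (biot_savart_form x y)"
  unfolding biot_savart_form_def
  by (rule linearI) (simp_all add: cross_add_left cross_mult_left scaleR_add_right mult.commute)

lemma continuous_biot_savart_form:
  "continuous_on {((x, y), u). x \<noteq> y} (\<lambda>((x, y), u). biot_savart_form x y u)"
  unfolding biot_savart_form_def case_prod_unfold
  by (intro continuous_intros continuous_on_cross) auto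

lemma has_biot_savart:
  assumes "C1_arc d" "x \<notin> path_image d"
  shows "has_line_integral (biot_savart_form x) d (biot_savart d x)"
  unfolding biot_savart_def
proof (rule C1_arc_line_integral[OF assms(1)])
  have "continuous_on (path_image d \<times> UNIV) (\<lambda>z. (\<lambda>((x, y), u). biot_savart_form x y u) ((x, fst z), snd z))"
    by (rule continuous_on_compose2[OF continuous_biot_savart_form])
      (use assms(2) in \<open>auto intro!: continuous_intros\<close>)
  then show "continuous_on (path_image d \<times> UNIV) (\<lambda>(y, u). biot_savart_form x y u)"
    by (simp add: case_prod_unfold)
qed

lemma continuous_biot_savart:
  assumes "C1_arc d"
  shows "continuous_on (- path_image d) (biot_savart d)"
proof -
  obtain d' where cont: "continuous_on {0..1} d'"
    and d': "\<And>t. t \<in> {0..1} \<Longrightarrow> (d has_vector_derivative d' t) (at t within {0..1})"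
    using assms unfolding C1_arc_def by blast
  have vd: "vector_derivative d (at t) = d' t" if "t \<in> {0..1} - {0, 1}" for t
    using d'[of t] that at_within_Icc_at[of 0 t 1] by (auto intro!: vector_derivative_at)
  have eq: "biot_savart d x = integral (cbox 0 1) (\<lambda>t. biot_savart_form x (d t) (d' t))" for x
    unfolding biot_savart_def line_integral_def cbox_interval
    by (rule integral_spike[of "{0, 1}"]) (auto simp: vd)
  have "continuous_on ((- path_image d) \<times> cbox 0 1)
      (\<lambda>z. (\<lambda>((x, y), u). biot_savart_form x y u) ((fst z, d (snd z)), d' (snd z)))"
    by (rule continuous_on_compose2[OF continuous_biot_savart_form])
      (auto intro!: continuous_intros continuous_on_compose2[OF cont]
        continuous_on_compose2[OF C1_arc_imp_continuous[OF assms]] simp: path_image_def)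
  then show ?thesis
    unfolding eq by (intro integral_continuous_on_param) (simp add: case_prod_unfold)
qed

text \<open>
  By the cyclic symmetry of the triple product, the derivative of \<open>c\<close> can be pulled out of the inner
  integral. The field is a parameter \<open>B\<close> here because \<open>d\<close> may have corners.
\<close>

lemma gauss_integral_eq_circulation:
  assumes B: "\<And>x. x \<in> path_image c \<Longrightarrow> has_line_integral (biot_savart_form x) d (B x)"
  shows "gauss_integral c d = line_integral (\<lambda>x u. u \<bullet> B x) c / (4 * pi)"
proof -
  have "integral {0..1} (\<lambda>t. (c s - d t) \<bullet> cross3 u (vector_derivative d (at t)) / norm (c s - d t) ^ 3)
      = u \<bullet> B (c s)" if "s \<in> {0..1}" for s u
  proof -
    have "c s \<in> path_image c" using that by (simp add: path_image_def)
    from has_integral_linear[OF has_line_integralD[OF B[OF this]] bounded_linear_inner_right[of u]]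
    have "((\<lambda>t. u \<bullet> biot_savart_form (c s) (d t) (vector_derivative d (at t))) has_integral u \<bullet> B (c s)) {0..1}"
      by (simp add: o_def)
    moreover have "u \<bullet> biot_savart_form x y w = (x - y) \<bullet> cross3 u w / norm (x - y) ^ 3" for x y w
      unfolding biot_savart_form_def using cross_triple[of u w "x - y"]
      by (simp add: divide_inverse inner_commute mult.commute)
    ultimately show ?thesis by (simp add: integral_unique)
  qed
  then have "integral {0..1} (\<lambda>s. integral {0..1} (\<lambda>t. (c s - d t) \<bullet>
        cross3 (vector_derivative c (at s)) (vector_derivative d (at t)) / norm (c s - d t) ^ 3))
      = line_integral (\<lambda>x u. u \<bullet> B x) c"
    unfolding line_integral_def by (intro integral_cong) simp
  then show ?thesis unfolding gauss_integral_def by simp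
qed

lemma has_line_integral_circulation:
  assumes "C1_arc c" "continuous_on (path_image c) B"
  shows "has_line_integral (\<lambda>x u. u \<bullet> B x) c (line_integral (\<lambda>x u. u \<bullet> B x) c)"
proof (rule C1_arc_line_integral[OF assms(1)])
  have "continuous_on (path_image c \<times> UNIV) (\<lambda>z. snd z \<bullet> B (fst z))"
    by (intro continuous_intros continuous_on_compose2[OF assms(2)]) auto
  then show "continuous_on (path_image c \<times> UNIV) (\<lambda>(x, u). u \<bullet> B x)"
    by (simp add: case_prod_unfold)
qed

lemma has_line_integral_walk:
  fixes L :: "real^3 \<Rightarrow> real^3 \<Rightarrow> 'b::banach"
  assumes "w \<noteq> []" and "\<And>e. e \<in> fst ` set w \<Longrightarrow> has_line_integral L (\<gamma> e) (I e)"
    and L: "\<And>x. linear (L x)"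
  shows "has_line_integral L (walk_path \<gamma> w) (\<Sum>s\<leftarrow>w. step_sign s *\<^sub>R I (fst s))"
  using assms(1,2)
proof (induction w rule: induct_list012)
  case (2 s)
  then show ?case
    using 2 has_line_integral_reversepath[of L, OF _ L] by (auto simp: step_path_def step_sign_def)
next
  case (3 s s' w)
  have "has_line_integral L (step_path \<gamma> s) (step_sign s *\<^sub>R I (fst s))"
    using "3.prems"(2)[of "fst s"] has_line_integral_reversepath[of L, OF _ L] by (auto simp: step_path_def step_sign_def)
  moreover have "has_line_integral L (walk_path \<gamma> (s' # w)) (\<Sum>s\<leftarrow>s' # w. step_sign s *\<^sub>R I (fst s))"
    by (rule 3(2)) (use 3(4) in auto)
  ultimately have "has_line_integral L (step_path \<gamma> s +++ walk_path \<gamma> (s' # w))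
      (step_sign s *\<^sub>R I (fst s) + (\<Sum>s\<leftarrow>s' # w. step_sign s *\<^sub>R I (fst s)))"
    by (rule has_line_integral_join[OF _ _ L])
  then show ?case by simp
qed simp

lemma path_image_walk_subset:
  "w \<noteq> [] \<Longrightarrow> path_image (walk_path \<gamma> w) \<subseteq> (\<Union>e\<in>fst ` set w. path_image (\<gamma> e))"
proof (induction w rule: induct_list012)
  case (3 s s' w)
  have "path_image (walk_path \<gamma> (s # s' # w))
      \<subseteq> path_image (step_path \<gamma> s) \<union> path_image (walk_path \<gamma> (s' # w))"
    using path_image_join_subset by simp
  also have "path_image (step_path \<gamma> s) = path_image (\<gamma> (fst s))"
    by (simp add: step_path_def)
  also have "\<dots> \<union> path_image (walk_path \<gamma> (s' # w))
      \<subseteq> path_image (\<gamma> (fst s)) \<union> (\<Union>e\<in>fst ` set (s' # w). path_image (\<gamma> e))"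
    by (intro Un_mono order_refl "3.IH"(2)) simp
  finally show ?case by simp
qed (auto simp: step_path_def)

text \<open>
  The field of the walk \<open>w'\<close> is the signed sum \<open>B\<close> of the fields of its arcs. This sum is continuous on
  the arcs of \<open>w\<close>, so its circulation exists along each of them and is additive in the field; the
  circulation along \<open>w\<close> then splits as well.
\<close>

lemma gauss_integral_walk:
  assumes ne: "w \<noteq> []" "w' \<noteq> []"
    and c: "\<And>e. e \<in> fst ` set w \<Longrightarrow> C1_arc (\<gamma> e)"
    and d: "\<And>e. e \<in> fst ` set w' \<Longrightarrow> C1_arc (\<delta> e)"
    and disj: "\<And>e f. e \<in> fst ` set w \<Longrightarrow> f \<in> fst ` set w' \<Longrightarrow> path_image (\<gamma> e) \<inter> path_image (\<delta> f) = {}"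
  shows "gauss_integral (walk_path \<gamma> w) (walk_path \<delta> w')
    = (\<Sum>s\<leftarrow>w. step_sign s * (\<Sum>s'\<leftarrow>w'. step_sign s' * gauss_integral (\<gamma> (fst s)) (\<delta> (fst s'))))"
proof -
  define B where "B x = (\<Sum>s'\<leftarrow>w'. step_sign s' *\<^sub>R biot_savart (\<delta> (fst s')) x)" for x
  have B: "has_line_integral (biot_savart_form x) (walk_path \<delta> w') (B x)"
    if "x \<in> path_image (walk_path \<gamma> w)" for x
  proof -
    have "x \<notin> path_image (\<delta> f)" if "f \<in> fst ` set w'" for f
      using \<open>x \<in> _\<close> path_image_walk_subset[OF ne(1), of \<gamma>] disj[OF _ that] by fastforce
    then show ?thesis
      unfolding B_def by (intro has_line_integral_walk ne d has_biot_savart linear_biot_savart_form)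
  qed
  have circ: "has_line_integral (\<lambda>x u. u \<bullet> B x) (\<gamma> e)
      (4 * pi * (\<Sum>s'\<leftarrow>w'. step_sign s' * gauss_integral (\<gamma> e) (\<delta> (fst s'))))"
    if e: "e \<in> fst ` set w" for e
  proof -
    let ?C = "\<lambda>u. line_integral (\<lambda>x h. h \<bullet> biot_savart (\<delta> (fst u)) x) (\<gamma> e)"
    have gauss: "?C s' = 4 * pi * gauss_integral (\<gamma> e) (\<delta> (fst s'))" if "s' \<in> set w'" for s'
      using gauss_integral_eq_circulation[of "\<gamma> e" "\<delta> (fst s')" "biot_savart (\<delta> (fst s'))"]
        has_biot_savart d disj[OF e] that by fastforce
    have cont: "continuous_on (path_image (\<gamma> e)) (biot_savart (\<delta> (fst s')))" if "s' \<in> set w'" for s'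
      by (rule continuous_on_subset[OF continuous_biot_savart]) (use that d disj[OF e] in fastforce)+
    \<comment> \<open>Additivity of the circulation in the field needs integrability of each partial sum, so continuity is carried through the induction.\<close>
    have "continuous_on (path_image (\<gamma> e)) (\<lambda>x. \<Sum>s'\<leftarrow>us. step_sign s' *\<^sub>R biot_savart (\<delta> (fst s')) x) \<and>
       line_integral (\<lambda>x h. h \<bullet> (\<Sum>s'\<leftarrow>us. step_sign s' *\<^sub>R biot_savart (\<delta> (fst s')) x)) (\<gamma> e)
        = (\<Sum>s'\<leftarrow>us. step_sign s' * ?C s')" if "set us \<subseteq> set w'" for us
      using that
    proof (induction us)
      case Nil
      show ?case by (simp add: line_integral_def)
    next
      case (Cons s' us)
      let ?F = "\<lambda>x. \<Sum>s'\<leftarrow>us. step_sign s' *\<^sub>R biot_savart (\<delta> (fst s')) x"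
      let ?G = "biot_savart (\<delta> (fst s'))"
      have F: "continuous_on (path_image (\<gamma> e)) ?F"
        "line_integral (\<lambda>x h. h \<bullet> ?F x) (\<gamma> e) = (\<Sum>s'\<leftarrow>us. step_sign s' * ?C s')"
        and G: "continuous_on (path_image (\<gamma> e)) ?G" using Cons cont by auto
      from has_integral_add[OF
          has_integral_mult_right[OF has_line_integralD[OF has_line_integral_circulation[OF c[OF e] G]],
            of "step_sign s'"]
          has_line_integralD[OF has_line_integral_circulation[OF c[OF e] F(1)]]]
      have "line_integral (\<lambda>x h. h \<bullet> (step_sign s' *\<^sub>R ?G x + ?F x)) (\<gamma> e)
          = step_sign s' * ?C s' + line_integral (\<lambda>x h. h \<bullet> ?F x) (\<gamma> e)"
        unfolding line_integral_def[of "\<lambda>x h. h \<bullet> (step_sign s' *\<^sub>R ?G x + ?F x)"]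
        by (intro integral_unique) (simp add: inner_add_right)
      then show ?case using F G by (auto intro!: continuous_intros)
    qed
    from this[of w'] have "continuous_on (path_image (\<gamma> e)) B"
      "line_integral (\<lambda>x h. h \<bullet> B x) (\<gamma> e) = (\<Sum>s'\<leftarrow>w'. step_sign s' * ?C s')"
      unfolding B_def by auto
    moreover have "(\<Sum>s'\<leftarrow>w'. step_sign s' * ?C s')
        = 4 * pi * (\<Sum>s'\<leftarrow>w'. step_sign s' * gauss_integral (\<gamma> e) (\<delta> (fst s')))"
      unfolding sum_list_const_mult[symmetric]
      by (intro arg_cong[where f = sum_list] map_cong refl) (simp add: gauss)
    ultimately show ?thesis using has_line_integral_circulation[OF c[OF e], of B] by simp
  qed
  have lin: "linear (\<lambda>u. u \<bullet> B x)" for x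
    by (rule linearI) (simp_all add: inner_add_left)
  have "line_integral (\<lambda>x u. u \<bullet> B x) (walk_path \<gamma> w) = (\<Sum>s\<leftarrow>w. step_sign s *\<^sub>R
      (4 * pi * (\<Sum>s'\<leftarrow>w'. step_sign s' * gauss_integral (\<gamma> (fst s)) (\<delta> (fst s')))))"
    by (intro line_integral_unique has_line_integral_walk ne circ lin)
  moreover have "gauss_integral (walk_path \<gamma> w) (walk_path \<delta> w')
      = line_integral (\<lambda>x u. u \<bullet> B x) (walk_path \<gamma> w) / (4 * pi)"
    by (rule gauss_integral_eq_circulation) (rule B)
  ultimately show ?thesis
    by (simp add: sum_list_const_mult mult.left_commute[of "step_sign _"])
qed

lemma gauss_integral_walk_chain:
  assumes "w \<noteq> []" "finite A" "fst ` set w \<subseteq> A"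
    and "\<And>e. e \<in> fst ` set w \<Longrightarrow> C1_arc (\<gamma> e)"
    and "\<And>e. e \<in> fst ` set w \<Longrightarrow> C1_arc (\<delta> e)"
    and "\<And>e f. e \<in> fst ` set w \<Longrightarrow> f \<in> fst ` set w \<Longrightarrow> path_image (\<gamma> e) \<inter> path_image (\<delta> f) = {}"
  shows "gauss_integral (walk_path \<gamma> w) (walk_path \<delta> w)
    = quadratic_form A (\<lambda>e f. gauss_integral (\<gamma> e) (\<delta> f)) (chain w)"
proof -
  have "gauss_integral (walk_path \<gamma> w) (walk_path \<delta> w)
      = (\<Sum>s\<leftarrow>w. step_sign s * (\<Sum>s'\<leftarrow>w. step_sign s' * gauss_integral (\<gamma> (fst s)) (\<delta> (fst s'))))"
    using assms by (intro gauss_integral_walk) auto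
  also have "\<dots> = (\<Sum>s\<leftarrow>w. step_sign s * (\<Sum>f\<in>A. chain w f * gauss_integral (\<gamma> (fst s)) (\<delta> f)))"
    by (simp only: sum_chain[OF assms(2,3)])
  also have "\<dots> = (\<Sum>e\<in>A. chain w e * (\<Sum>f\<in>A. chain w f * gauss_integral (\<gamma> e) (\<delta> f)))"
    by (rule sum_chain[OF assms(2,3), symmetric])
  finally show ?thesis by (simp add: quadratic_form_def sum_distrib_left mult.assoc)
qed

section \<open>Parity of the Thurston--Bennequin numbers\<close>

lemma walk_path_compose:
  "w \<noteq> [] \<Longrightarrow> walk_path (\<lambda>e. f \<circ> \<gamma> e) w = f \<circ> walk_path \<gamma> w"
proof (induction w rule: induct_list012)
  case (3 s s' w)
  have "step_path (\<lambda>e. f \<circ> \<gamma> e) s = f \<circ> step_path \<gamma> s"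
    by (simp add: step_path_def reversepath_def fun_eq_iff)
  moreover have "walk_path (\<lambda>e. f \<circ> \<gamma> e) (s' # w) = f \<circ> walk_path \<gamma> (s' # w)"
    by (rule "3.IH"(2)) simp
  ultimately show ?case by (simp only: walk_path.simps path_compose_join)
qed (auto simp: step_path_def reversepath_def fun_eq_iff)

lemma path_image_edge_subset_walk:
  assumes "successively (\<lambda>s s'. pathfinish (step_path \<gamma> s) = pathstart (step_path \<gamma> s')) w"
    and "e \<in> fst ` set w"
  shows "path_image (\<gamma> e) \<subseteq> path_image (walk_path \<gamma> w)"
proof -
  have image: "path_image (step_path \<gamma> s) = path_image (\<gamma> (fst s))" for s
    by (simp add: step_path_def)
  have start: "pathstart (walk_path \<gamma> (s # w)) = pathstart (step_path \<gamma> s)" for s w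
    by (cases w) simp_all
  show ?thesis
    using assms
  proof (induction w rule: induct_list012)
    case (3 s s' w)
    have "path_image (walk_path \<gamma> (s # s' # w))
        = path_image (\<gamma> (fst s)) \<union> path_image (walk_path \<gamma> (s' # w))"
      using "3.prems"(1) start[of s' w] image[of s] by (simp add: path_image_join)
    moreover have "path_image (\<gamma> e) \<subseteq> path_image (walk_path \<gamma> (s' # w))"
      if "e \<in> fst ` set (s' # w)"
      by (rule "3.IH"(2)) (use "3.prems"(1) that in auto)
    ultimately show ?case using "3.prems"(2) by auto
  qed (auto simp: image)
qed

text \<open>
  The form depends on \<open>\<epsilon>\<close> but not on the cycle. Two arcs \<open>e\<close> and \<open>f\<close> of the cycle satisfy the disjointness
  required for the splitting, since the whole cycle is disjoint from its push-off.
\<close>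

lemma eventually_tb_eq_quadratic_form:
  assumes G: "fin_digraph G" and v: "transverse_field v"
    and real: "legendrian_realization G p \<gamma>" and w: "cycle G w"
    and tb: "has_tb v (walk_path \<gamma> w) m"
  shows "\<forall>\<^sub>F \<epsilon> in at_right 0. quadratic_form (arcs G)
    (\<lambda>e f. gauss_integral (\<gamma> e) (\<lambda>t. \<gamma> f t + \<epsilon> *\<^sub>R v (\<gamma> f t))) (chain w) = of_int m"
  using tb unfolding has_tb_def
proof (rule eventually_mono)
  fix \<epsilon> :: real
  define push where "push = (\<lambda>q. q + \<epsilon> *\<^sub>R v q)"
  define \<delta> where "\<delta> = (\<lambda>e. push \<circ> \<gamma> e)"
  let ?c = "walk_path \<gamma> w"
  assume lk: "has_linking_number ?c (\<lambda>t. ?c t + \<epsilon> *\<^sub>R v (?c t)) m"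
  have ne: "w \<noteq> []" and wA: "fst ` set w \<subseteq> arcs G" using w by (auto simp: cycle_def)
  have push_c: "(\<lambda>t. ?c t + \<epsilon> *\<^sub>R v (?c t)) = push \<circ> ?c"
    by (simp add: push_def o_def)
  have \<delta>_walk: "walk_path \<delta> w = push \<circ> ?c"
    unfolding \<delta>_def by (rule walk_path_compose[OF ne])
  have C1: "C1_arc (\<gamma> e)" if "e \<in> fst ` set w" for e
  proof (rule smooth_on_imp_C1_arc)
    have "e \<in> arcs G" using that wA by blast
    then show "smooth_on {0..1} (\<gamma> e)"
      using real by (simp add: legendrian_realization_def legendrian_on_def)
  qed
  have C1': "C1_arc (\<delta> e)" if "e \<in> fst ` set w" for e
    using C1_arc_push_off[OF C1[OF that] v] by (simp add: \<delta>_def push_def o_def)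
  have disj: "path_image (\<gamma> e) \<inter> path_image (\<delta> f) = {}"
    if "e \<in> fst ` set w" "f \<in> fst ` set w" for e f
  proof -
    have ends: "pathstart (step_path \<gamma> s) = p (step_start G s)"
        "pathfinish (step_path \<gamma> s) = p (step_end G s)" if "fst s \<in> arcs G" for s
      using real that unfolding legendrian_realization_def
      by (auto simp: step_path_def step_start_def step_end_def)
    have "successively (\<lambda>s s'. pathfinish (step_path \<gamma> s) = pathstart (step_path \<gamma> s')) w"
      unfolding successively_conv_nth
    proof (intro allI impI)
      fix i assume i: "Suc i < length w"
      then have "step_end G (w ! i) = step_start G (w ! Suc i)"
        using w unfolding cycle_def by (metis Suc_lessD mod_less)
      moreover have "fst (w ! i) \<in> arcs G" "fst (w ! Suc i) \<in> arcs G"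
        using wA i by (auto intro!: subsetD[OF wA] imageI nth_mem)
      ultimately show "pathfinish (step_path \<gamma> (w ! i)) = pathstart (step_path \<gamma> (w ! Suc i))"
        by (simp add: ends)
    qed
    note sub = path_image_edge_subset_walk[OF this]
    have "path_image (\<delta> f) \<subseteq> path_image (push \<circ> ?c)"
      using sub[OF that(2)] by (auto simp: \<delta>_def path_image_compose)
    moreover have "path_image ?c \<inter> path_image (push \<circ> ?c) = {}"
      using lk unfolding has_linking_number_def push_c by blast
    ultimately show ?thesis using sub[OF that(1)] by blast
  qed
  have "gauss_integral ?c (push \<circ> ?c)
      = quadratic_form (arcs G) (\<lambda>e f. gauss_integral (\<gamma> e) (\<delta> f)) (chain w)"
    unfolding \<delta>_walk[symmetric]
    by (rule gauss_integral_walk_chain[OF ne fin_digraph.finite_arcs[OF G] wA C1 C1' disj])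
  then show "quadratic_form (arcs G)
      (\<lambda>e f. gauss_integral (\<gamma> e) (\<lambda>t. \<gamma> f t + \<epsilon> *\<^sub>R v (\<gamma> f t))) (chain w) = of_int m"
    using lk unfolding has_linking_number_def push_c by (simp add: \<delta>_def push_def o_def)
qed

lemma has_max_tb_unique: "has_max_tb v \<kappa> m \<Longrightarrow> has_max_tb v \<kappa> n \<Longrightarrow> m = n"
  unfolding has_max_tb_def by (meson order_antisym)

theorem theorem1p2:
  fixes G :: "('v, 'e) pre_digraph" and v :: "real^3 \<Rightarrow> real^3"
  assumes "fin_digraph G"
    and "minor (complete_graph 4) G"
    and "transverse_field v"
  shows "\<not> (\<exists>(p :: 'v \<Rightarrow> real^3) (\<gamma> :: 'e \<Rightarrow> real \<Rightarrow> real^3).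
           legendrian_realization G p \<gamma> \<and>
           (\<forall>w. cycle G w \<longrightarrow>
              knot_class (path_image (walk_path \<gamma> w)) \<in> L_odd v \<and>
              (\<exists>m. has_max_tb v (knot_class (path_image (walk_path \<gamma> w))) m \<and>
                   has_tb v (walk_path \<gamma> w) m)))"
proof (intro notI, elim exE conjE)
  fix p :: "'v \<Rightarrow> real^3" and \<gamma> :: "'e \<Rightarrow> real \<Rightarrow> real^3"
  assume real: "legendrian_realization G p \<gamma>"
    and max_odd: "\<forall>w. cycle G w \<longrightarrow>
              knot_class (path_image (walk_path \<gamma> w)) \<in> L_odd v \<and>
              (\<exists>m. has_max_tb v (knot_class (path_image (walk_path \<gamma> w))) m \<and>
                   has_tb v (walk_path \<gamma> w) m)"
  define Q where "Q \<epsilon> = quadratic_form (arcs G)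
    (\<lambda>e f. gauss_integral (\<gamma> e) (\<lambda>t. \<gamma> f t + \<epsilon> *\<^sub>R v (\<gamma> f t)))" for \<epsilon>
  have Q_odd: "\<forall>\<^sub>F \<epsilon> in at_right 0. \<exists>m. odd m \<and> Q \<epsilon> x = of_int m" if x: "x \<in> cycle_chains G" for x
  proof -
    obtain w where w: "cycle G w" "x = chain w" using x by (auto simp: cycle_chains_def)
    obtain m where m: "has_max_tb v (knot_class (path_image (walk_path \<gamma> w))) m"
        "has_tb v (walk_path \<gamma> w) m"
      using max_odd w(1) by blast
    have "odd m"
      using max_odd w(1) m(1) has_max_tb_unique unfolding L_odd_def by blast
    then show ?thesis
      using eventually_tb_eq_quadratic_form[OF assms(1,3) real w(1) m(2)]
      unfolding Q_def w(2) by (auto elim: eventually_mono)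
  qed
  obtain a b c where abc: "{a, b, c, a + b, b + c, c + a, a + b + c} \<subseteq> cycle_chains G"
    using tetrahedral_if_minor_complete_graph_4[OF assms(1,2)] unfolding tetrahedral_def by blast
  \<comment> \<open>Seven cycles are finitely many, so one \<open>\<epsilon>\<close> works for all of them.\<close>
  have "\<forall>\<^sub>F \<epsilon> in at_right 0. \<forall>x\<in>{a, b, c, a + b, b + c, c + a, a + b + c}.
      \<exists>m. odd m \<and> Q \<epsilon> x = of_int m"
    using abc Q_odd by (intro eventually_ball_finite) auto
  then obtain \<epsilon> where \<epsilon>: "\<And>x. x \<in> {a, b, c, a + b, b + c, c + a, a + b + c} \<Longrightarrow>
      \<exists>m. odd m \<and> Q \<epsilon> x = of_int m"
    using eventually_happens[of _ "at_right (0::real)"] by fastforce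
  obtain ka kb kc kab kbc kca kabc where odd:
      "odd ka" "odd kb" "odd kc" "odd kab" "odd kbc" "odd kca" "odd kabc"
    and k: "Q \<epsilon> a = of_int ka" "Q \<epsilon> b = of_int kb" "Q \<epsilon> c = of_int kc"
      "Q \<epsilon> (a + b) = of_int kab" "Q \<epsilon> (b + c) = of_int kbc" "Q \<epsilon> (c + a) = of_int kca"
      "Q \<epsilon> (a + b + c) = of_int kabc"
    using \<epsilon>[of a] \<epsilon>[of b] \<epsilon>[of c] \<epsilon>[of "a + b"] \<epsilon>[of "b + c"] \<epsilon>[of "c + a"] \<epsilon>[of "a + b + c"]
    by auto
  have "Q \<epsilon> a + Q \<epsilon> b + Q \<epsilon> c + Q \<epsilon> (a + b + c) = Q \<epsilon> (a + b) + Q \<epsilon> (b + c) + Q \<epsilon> (c + a)"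
    unfolding Q_def by (rule quadratic_form_polarization)
  then have "ka + kb + kc + kabc = kab + kbc + kca"
    unfolding k by (simp flip: of_int_add)
  then have "even (kab + kbc + kca)" using odd by (metis odd_even_add even_add)
  then show False using odd by simp
qed

end
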